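(* Let $\mathscr{A}$ be a complex ${}^*$-algebra (not necessarily unital), let $\mathscr{I}\subseteq\mathscr{A}$ be a left ideal, and let $f:\mathscr{I}\to\mathbb{C}$ be a linear functional. The following assertions are equivalent: (i) There is a representable functional $\widetilde f:\mathscr{A}\to\mathbb{C}$ extending $f$. (ii) $f$ is admissible and Hilbert bounded. If there is any representable extension, then there is a minimal one, denoted $f_N$, among the set of representable extensions of $f$ (i.e. $f_N$ is a representable extension of $f$ and $f_N\leq\widetilde f$ for every representable extension $\widetilde f$ of $f$).
   Context: A linear functional $f$ on $\mathscr{A}$ is representable if there exist a Hilbert space $H$, a ${}^*$-homomorphism $\pi:\mathscr{A}\to\mathscr{B}(H)$ and a vector $\xi\in H$ such that $f(a)=(\pi(a)\xi\,|\,\xi)$ for all $a\in\mathscr{A}$. A linear functional $f:\mathscr{I}\to\mathbb{C}$ is Hilbert bounded if there is a constant $M\geq 0$ with $|f(a)|^2\leq Mf(a^*a)$ for all $a\in\mathscr{I}$; it is admissible if for every $x\in\mathscr{A}$ there exists $\lambda_x\geq 0$ with $f(a^*x^*xa)\leq\lambda_xf(a^*a)$ for all $a\in\mathscr{I}$. For linear functionals $f,g$ on $\mathscr{A}$, $f\leq g$ means that $g-f$ is positive, i.e. $(g-f)(x^*x)\geq 0$ for all $x\in\mathscr{A}$. *)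

theory Defs
  imports "HOL-Library.Function_Algebras" "HOL-Library.Complex_Order"
begin

section \<open>Complex vector spaces and complex star-algebras\<close>

class scaleC =
  fixes scaleC :: "complex \<Rightarrow> 'a \<Rightarrow> 'a" (infixr "*\<^sub>C" 75)

class complex_vector = scaleC + ab_group_add +
  assumes scaleC_add_right: "c *\<^sub>C (x + y) = c *\<^sub>C x + c *\<^sub>C y"
    and scaleC_add_left: "(c + d) *\<^sub>C x = c *\<^sub>C x + d *\<^sub>C x"
    and scaleC_scaleC: "c *\<^sub>C d *\<^sub>C x = (c * d) *\<^sub>C x"
    and scaleC_one: "1 *\<^sub>C x = x"

global_interpretation cvec: vector_space "scaleC :: complex \<Rightarrow> 'a \<Rightarrow> 'a::complex_vector"
  by standard (simp_all add: scaleC_add_right scaleC_add_left scaleC_scaleC scaleC_one)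

abbreviation csubspace :: "'a::complex_vector set \<Rightarrow> bool"
  where "csubspace \<equiv> cvec.subspace"

instantiation complex :: complex_vector
begin
definition scaleC_complex_def: "c *\<^sub>C (z::complex) = c * z"
instance by standard (simp_all add: scaleC_complex_def algebra_simps)
end

instantiation "fun" :: (type, complex_vector) complex_vector
begin
definition scaleC_fun_def: "c *\<^sub>C f = (\<lambda>x. c *\<^sub>C f x)"
instance
  by standard
    (simp_all add: scaleC_fun_def fun_eq_iff scaleC_add_right scaleC_add_left scaleC_scaleC scaleC_one)
end

text \<open>No unit is assumed: class \<^class>\<open>ring\<close> is the class of associative rings without unit.\<close>

class complex_star_algebra = ring + complex_vector +
  fixes star :: "'a \<Rightarrow> 'a"
  assumes scaleC_mult_left: "(c *\<^sub>C x) * y = c *\<^sub>C (x * y)"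
    and scaleC_mult_right: "x * (c *\<^sub>C y) = c *\<^sub>C (x * y)"
    and star_star: "star (star x) = x"
    and star_add: "star (x + y) = star x + star y"
    and star_scaleC: "star (c *\<^sub>C x) = cnj c *\<^sub>C star x"
    and star_mult: "star (x * y) = star y * star x"

definition left_ideal :: "'a::complex_star_algebra set \<Rightarrow> bool"
  where "left_ideal I \<longleftrightarrow> csubspace I \<and> (\<forall>a. \<forall>x\<in>I. a * x \<in> I)"

definition clinear_on :: "'a::complex_vector set \<Rightarrow> ('a \<Rightarrow> 'b::complex_vector) \<Rightarrow> bool"
  where "clinear_on S T \<longleftrightarrow>
    (\<forall>x\<in>S. \<forall>y\<in>S. T (x + y) = T x + T y) \<and> (\<forall>c. \<forall>x\<in>S. T (c *\<^sub>C x) = c *\<^sub>C T x)"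


section \<open>Hilbert spaces and representations\<close>

text \<open>
  A Hilbert space is a subspace \<open>V\<close> of some ambient complex vector space, with an inner product
  \<open>ip\<close> that is linear in the first argument. Nothing is required of \<open>ip\<close> outside \<open>V\<close>.
\<close>

definition hnorm :: "('h \<Rightarrow> 'h \<Rightarrow> complex) \<Rightarrow> 'h \<Rightarrow> real"
  where "hnorm ip x = sqrt (Re (ip x x))"

locale complex_hilbert_space =
  fixes V :: "'h::complex_vector set" and ip :: "'h \<Rightarrow> 'h \<Rightarrow> complex"
  assumes subspace_V: "csubspace V"
    and ip_linear: "y \<in> V \<Longrightarrow> clinear_on V (\<lambda>x. ip x y)"
    and ip_cnj: "x \<in> V \<Longrightarrow> y \<in> V \<Longrightarrow> ip y x = cnj (ip x y)"
    and ip_nonneg: "x \<in> V \<Longrightarrow> 0 \<le> ip x x"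
    and ip_definite: "x \<in> V \<Longrightarrow> ip x x = 0 \<Longrightarrow> x = 0"
    and complete_V: "(\<forall>n. X n \<in> V) \<Longrightarrow>
      (\<forall>e>0. \<exists>N. \<forall>m\<ge>N. \<forall>n\<ge>N. hnorm ip (X m - X n) < e) \<Longrightarrow>
      \<exists>l\<in>V. (\<lambda>n. hnorm ip (X n - l)) \<longlonglongrightarrow> 0"

definition bounded_operator ::
    "'h::complex_vector set \<Rightarrow> ('h \<Rightarrow> 'h \<Rightarrow> complex) \<Rightarrow> ('h \<Rightarrow> 'h) \<Rightarrow> bool"
  where "bounded_operator V ip T \<longleftrightarrow>
    (\<forall>x\<in>V. T x \<in> V) \<and> clinear_on V T \<and> (\<exists>B. \<forall>x\<in>V. hnorm ip (T x) \<le> B * hnorm ip x)"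

definition adjoint_of ::
    "'h set \<Rightarrow> ('h \<Rightarrow> 'h \<Rightarrow> complex) \<Rightarrow> ('h \<Rightarrow> 'h) \<Rightarrow> ('h \<Rightarrow> 'h) \<Rightarrow> bool"
  where "adjoint_of V ip T S \<longleftrightarrow> (\<forall>x\<in>V. \<forall>y\<in>V. ip (T x) y = ip x (S y))"

text \<open>
  Star-homomorphisms into the bounded operators on \<open>V\<close>. Operators are compared on \<open>V\<close> only, and no
  nondegeneracy is required.
\<close>

locale star_representation = complex_hilbert_space V ip
  for V :: "'h::complex_vector set" and ip :: "'h \<Rightarrow> 'h \<Rightarrow> complex" +
  fixes \<pi> :: "'a::complex_star_algebra \<Rightarrow> 'h \<Rightarrow> 'h"
  assumes pi_bounded: "bounded_operator V ip (\<pi> a)"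
    and pi_add: "x \<in> V \<Longrightarrow> \<pi> (a + b) x = \<pi> a x + \<pi> b x"
    and pi_scaleC: "x \<in> V \<Longrightarrow> \<pi> (c *\<^sub>C a) x = c *\<^sub>C \<pi> a x"
    and pi_mult: "x \<in> V \<Longrightarrow> \<pi> (a * b) x = \<pi> a (\<pi> b x)"
    and pi_star: "adjoint_of V ip (\<pi> a) (\<pi> (star a))"

definition represents ::
    "'h::complex_vector set \<Rightarrow> ('h \<Rightarrow> 'h \<Rightarrow> complex) \<Rightarrow> ('a::complex_star_algebra \<Rightarrow> 'h \<Rightarrow> 'h)
      \<Rightarrow> 'h \<Rightarrow> ('a \<Rightarrow> complex) \<Rightarrow> bool"
  where "represents V ip \<pi> \<xi> f \<longleftrightarrow>
    star_representation V ip \<pi> \<and> \<xi> \<in> V \<and> (\<forall>a. f a = ip (\<pi> a \<xi>) \<xi>)"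

text \<open>
  HOL cannot quantify existentially over types, so the Hilbert space below is required to live inside
  one fixed vector space, the functions \<open>'a option \<Rightarrow> complex\<close>; its inner product is arbitrary.
  This is no restriction: by \<open>representableI\<close> below, a linear functional represented on a Hilbert
  space over any type whatsoever is representable in this sense.
\<close>

definition representable :: "('a::complex_star_algebra \<Rightarrow> complex) \<Rightarrow> bool"
  where "representable f \<longleftrightarrow> clinear_on UNIV f \<and>
    (\<exists>(V :: ('a option \<Rightarrow> complex) set) ip \<pi> \<xi>. represents V ip \<pi> \<xi> f)"


section \<open>Properties of functionals\<close>

text \<open>
  A functional on \<open>I\<close> is a function on the whole type of which only the values on \<open>I\<close> are used.
  In the inequalities, \<open>\<le>\<close> is the order of \<^theory>\<open>HOL-Library.Complex_Order\<close>, under which \<open>z \<le> w\<close>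
  means that \<open>w - z\<close> is real and nonnegative.
\<close>

definition hilbert_bounded :: "'a::complex_star_algebra set \<Rightarrow> ('a \<Rightarrow> complex) \<Rightarrow> bool"
  where "hilbert_bounded I f \<longleftrightarrow>
    (\<exists>M::real. M \<ge> 0 \<and> (\<forall>a\<in>I. of_real ((cmod (f a))\<^sup>2) \<le> of_real M * f (star a * a)))"

definition admissible :: "'a::complex_star_algebra set \<Rightarrow> ('a \<Rightarrow> complex) \<Rightarrow> bool"
  where "admissible I f \<longleftrightarrow>
    (\<forall>x. \<exists>L::real. L \<ge> 0 \<and>
      (\<forall>a\<in>I. f (star a * star x * x * a) \<le> of_real L * f (star a * a)))"

definition positive_functional :: "('a::complex_star_algebra \<Rightarrow> complex) \<Rightarrow> bool"
  where "positive_functional f \<longleftrightarrow> (\<forall>x. 0 \<le> f (star x * x))"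

text \<open>Not the pointwise order that \<open>\<le>\<close> denotes on functions.\<close>

definition functional_le ::
    "('a::complex_star_algebra \<Rightarrow> complex) \<Rightarrow> ('a \<Rightarrow> complex) \<Rightarrow> bool" (infix "\<preceq>" 50)
  where "f \<preceq> g \<longleftrightarrow> positive_functional (g - f)"

definition representable_extension ::
    "'a::complex_star_algebra set \<Rightarrow> ('a \<Rightarrow> complex) \<Rightarrow> ('a \<Rightarrow> complex) \<Rightarrow> bool"
  where "representable_extension I f g \<longleftrightarrow> representable g \<and> (\<forall>a\<in>I. g a = f a)"


section \<open>Representability does not depend on the ambient space\<close>

context complex_hilbert_space
begin

lemma V_0: "0 \<in> V" and V_add: "x \<in> V \<Longrightarrow> y \<in> V \<Longrightarrow> x + y \<in> V"
  and V_scale: "x \<in> V \<Longrightarrow> c *\<^sub>C x \<in> V" and V_diff: "x \<in> V \<Longrightarrow> y \<in> V \<Longrightarrow> x - y \<in> V"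
  using subspace_V cvec.subspace_0 cvec.subspace_add cvec.subspace_scale cvec.subspace_diff by blast+

lemma ip_add_left: "x \<in> V \<Longrightarrow> y \<in> V \<Longrightarrow> z \<in> V \<Longrightarrow> ip (x + y) z = ip x z + ip y z"
  and ip_scale_left: "x \<in> V \<Longrightarrow> z \<in> V \<Longrightarrow> ip (c *\<^sub>C x) z = c * ip x z"
  using ip_linear[of z] by (auto simp: clinear_on_def scaleC_complex_def)

lemma ip_add_right: "x \<in> V \<Longrightarrow> y \<in> V \<Longrightarrow> z \<in> V \<Longrightarrow> ip z (x + y) = ip z x + ip z y"
  by (metis V_add complex_cnj_add ip_add_left ip_cnj)

lemma ip_scale_right: "x \<in> V \<Longrightarrow> z \<in> V \<Longrightarrow> ip z (c *\<^sub>C x) = cnj c * ip z x"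
  by (metis V_scale complex_cnj_mult ip_cnj ip_scale_left)

lemma ip_0_left: "z \<in> V \<Longrightarrow> ip 0 z = 0"
  using ip_scale_left[of 0 z 0] V_0 by simp

lemma ip_diff_left: "x \<in> V \<Longrightarrow> y \<in> V \<Longrightarrow> z \<in> V \<Longrightarrow> ip (x - y) z = ip x z - ip y z"
  using ip_add_left[of "x - y" y z] V_diff by simp

lemma ip_diff_right: "x \<in> V \<Longrightarrow> y \<in> V \<Longrightarrow> z \<in> V \<Longrightarrow> ip z (x - y) = ip z x - ip z y"
  using ip_add_right[of "x - y" y z] V_diff by simp

lemma ip_self: "x \<in> V \<Longrightarrow> ip x x = of_real ((hnorm ip x)\<^sup>2)"
  using ip_nonneg[of x] by (auto simp: hnorm_def less_eq_complex_def complex_eq_iff)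

lemma Cauchy_Schwarz:
  assumes x: "x \<in> V" and y: "y \<in> V"
  shows "cmod (ip x y) \<le> hnorm ip x * hnorm ip y"
proof (cases "ip y y = 0")
  case True
  then have "y = 0" using ip_definite y by blast
  then have "ip x y = 0" using ip_cnj[OF y x] ip_0_left[OF x] by simp
  then show ?thesis using ip_nonneg[OF x] ip_nonneg[OF y] by (simp add: hnorm_def less_eq_complex_def)
next
  case False
  define q where "q = (hnorm ip y)\<^sup>2"
  define p where "p = (hnorm ip x)\<^sup>2"
  have q: "ip y y = of_real q" and p: "ip x x = of_real p"
    using ip_self x y by (auto simp: q_def p_def)
  have q0: "q > 0" using False q by (auto simp: q_def)
  define t where "t = ip x y / of_real q"
  let ?z = "x - t *\<^sub>C y"
  have z: "t *\<^sub>C y \<in> V" "?z \<in> V" using x y V_diff V_scale by auto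
  have "ip ?z ?z = ip x x - cnj t * ip x y - t * ip y x + t * cnj t * ip y y"
    using x y z by (simp add: ip_diff_left ip_diff_right ip_scale_left ip_scale_right algebra_simps)
  also have "\<dots> = of_real p - ip x y * cnj (ip x y) / of_real q"
    using q0 by (simp add: q p t_def ip_cnj[OF x y] field_simps)
  also have "\<dots> = of_real (p - (cmod (ip x y))\<^sup>2 / q)"
    using complex_norm_square[of "ip x y"] by simp
  finally have "0 \<le> p - (cmod (ip x y))\<^sup>2 / q"
    using ip_nonneg[OF z(2)] by (simp add: less_eq_complex_def)
  then have "(cmod (ip x y))\<^sup>2 \<le> p * q" using q0 by (simp add: field_simps)
  then have "(cmod (ip x y))\<^sup>2 \<le> (hnorm ip x * hnorm ip y)\<^sup>2"
    by (simp add: p_def q_def power_mult_distrib)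
  moreover have "0 \<le> hnorm ip x * hnorm ip y"
    using ip_nonneg[OF x] ip_nonneg[OF y] by (simp add: hnorm_def less_eq_complex_def)
  ultimately show ?thesis by (rule power2_le_imp_le)
qed

end

lemma representableI:
  fixes V :: "'h::complex_vector set" and f :: "'a::complex_star_algebra \<Rightarrow> complex"
  assumes lin: "clinear_on UNIV f" and rep: "represents V ip \<pi> \<xi> f"
  shows "representable f"
proof -
  interpret star_representation V ip \<pi> using rep by (simp add: represents_def)
  have \<xi>: "\<xi> \<in> V" and f: "\<And>a. f a = ip (\<pi> a \<xi>) \<xi>" using rep by (auto simp: represents_def)
  have piV: "\<pi> a x \<in> V" if "x \<in> V" for a x
    using pi_bounded[of a] that by (auto simp: bounded_operator_def)
  have pil: "clinear_on V (\<pi> a)" for a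
    using pi_bounded[of a] by (auto simp: bounded_operator_def)
  have adj: "ip (\<pi> a x) y = ip x (\<pi> (star a) y)" if "x \<in> V" "y \<in> V" for a x y
    using pi_star[of a] that by (auto simp: adjoint_of_def)
  define P where "P = {v \<in> V. ip v \<xi> = 0 \<and> (\<forall>a. ip v (\<pi> a \<xi>) = 0)}"
  define W where "W = {w \<in> V. \<forall>v\<in>P. ip w v = 0}"
  have WV: "w \<in> V" if "w \<in> W" for w using that by (simp add: W_def)
  have W0: "ip w v = 0" if "w \<in> W" "v \<in> P" for w v using that by (simp add: W_def)
  have PV: "v \<in> V" if "v \<in> P" for v using that by (simp add: P_def)
  have subW: "csubspace W"
    by (rule cvec.subspaceI)
      (auto simp: W_def V_0 V_add V_scale PV ip_0_left ip_add_left ip_scale_left)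
  have Wadd: "x + y \<in> W" and Wdiff: "x - y \<in> W" if "x \<in> W" "y \<in> W" for x y
    using that subW cvec.subspace_add cvec.subspace_diff by blast+
  have Wsc: "c *\<^sub>C x \<in> W" if "x \<in> W" for c x
    using that subW cvec.subspace_scale by blast
  have Ppi: "\<pi> a v \<in> P" if v: "v \<in> P" for a v
  proof -
    have "ip (\<pi> a v) \<xi> = 0" "ip (\<pi> a v) (\<pi> b \<xi>) = 0" for b
      using v \<xi> PV[OF v] by (auto simp: P_def adj piV pi_mult[OF \<xi>, symmetric])
    then show ?thesis using PV[OF v] piV by (auto simp: P_def)
  qed
  have Wpi: "\<pi> a w \<in> W" if w: "w \<in> W" for a w
    using w Ppi PV piV by (auto simp: W_def adj)
  have \<xi>W: "\<xi> \<in> W"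
    using \<xi> ip_cnj by (auto simp: W_def P_def)
  define T :: "'h \<Rightarrow> 'a option \<Rightarrow> complex"
    where "T w = (\<lambda>i. case i of None \<Rightarrow> ip w \<xi> | Some a \<Rightarrow> ip w (\<pi> a \<xi>))" for w
  have Tadd: "T (x + y) = T x + T y" and Tdiff: "T (x - y) = T x - T y" if "x \<in> V" "y \<in> V" for x y
    using that \<xi> piV
    by (auto simp: T_def fun_eq_iff ip_add_left ip_diff_left split: option.splits)
  have Tsc: "T (c *\<^sub>C x) = c *\<^sub>C T x" if "x \<in> V" for c x
    using that \<xi> piV
    by (auto simp: T_def fun_eq_iff scaleC_fun_def scaleC_complex_def ip_scale_left split: option.splits)
  have T0: "w = 0" if w: "w \<in> W" and 0: "T w = 0" for w
  proof -
    have "ip w \<xi> = 0" "ip w (\<pi> a \<xi>) = 0" for a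
      using fun_cong[OF 0, of None] fun_cong[OF 0, of "Some a"] by (auto simp: T_def)
    then have "w \<in> P" using WV[OF w] by (auto simp: P_def)
    then have "ip w w = 0" using w by (auto simp: W_def)
    then show ?thesis using ip_definite WV[OF w] by blast
  qed
  have inj: "inj_on T W"
  proof (rule inj_onI)
    fix x y assume xy: "x \<in> W" "y \<in> W" "T x = T y"
    then have "T (x - y) = 0" using WV by (simp add: Tdiff)
    then show "x = y" using T0[OF Wdiff] xy by fastforce
  qed
  define S where "S = inv_into W T"
  have ST: "S (T w) = w" if "w \<in> W" for w using inj that by (simp add: S_def)
  define jp where "jp u v = ip (S u) (S v)" for u v
  define \<rho> where "\<rho> a u = T (\<pi> a (S u))" for a u
  have jT: "jp (T u) (T v) = ip u v" if "u \<in> W" "v \<in> W" for u v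
    using that by (simp add: jp_def ST)
  have nT: "hnorm jp (T u) = hnorm ip u" if "u \<in> W" for u
    using that by (simp add: hnorm_def jT)
  have rT: "\<rho> a (T u) = T (\<pi> a u)" if "u \<in> W" for a u
    using that by (simp add: \<rho>_def ST)
  note tr = jT nT rT Wadd Wdiff Wsc Wpi \<xi>W WV
  have T_0: "T 0 = 0" using Tdiff[OF V_0 V_0] by simp
  have TA: "T x + T y = T (x + y)" and TD: "T x - T y = T (x - y)"
    and TS: "c *\<^sub>C T x = T (c *\<^sub>C x)" if "x \<in> W" "y \<in> W" for c x y
    using that WV by (simp_all add: Tadd Tdiff Tsc)
  have hil: "complex_hilbert_space (T ` W) jp"
  proof
    show "csubspace (T ` W)"
    proof (rule cvec.subspaceI)
      show "0 \<in> T ` W" using T_0 cvec.subspace_0[OF subW] by (metis image_eqI)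
    qed (auto simp: TA TS Wadd Wsc)
    show "clinear_on (T ` W) (\<lambda>x. jp x y)" if "y \<in> T ` W" for y
      using that
      by (auto simp: clinear_on_def scaleC_complex_def TA TS tr ip_add_left ip_scale_left)
    show "jp y x = cnj (jp x y)" if "x \<in> T ` W" "y \<in> T ` W" for x y
      using that by (auto simp: tr intro!: ip_cnj)
    show "0 \<le> jp x x" if "x \<in> T ` W" for x
      using that by (auto simp: tr intro!: ip_nonneg)
    show "x = 0" if x: "x \<in> T ` W" "jp x x = 0" for x
    proof -
      obtain w where w: "w \<in> W" "x = T w" using x(1) by blast
      have "ip w w = 0" using x(2) w jT[of w w] by simp
      then have "w = 0" using ip_definite WV[OF w(1)] by blast
      then show ?thesis using w T_0 by simp
    qed
    show "\<exists>l\<in>T ` W. (\<lambda>n. hnorm jp (X n - l)) \<longlonglongrightarrow> 0"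
      if X: "\<forall>n. X n \<in> T ` W"
        and C: "\<forall>e>0. \<exists>N. \<forall>m\<ge>N. \<forall>n\<ge>N. hnorm jp (X m - X n) < e" for X
    proof -
      have "\<forall>n. \<exists>w. w \<in> W \<and> X n = T w" using X by blast
      then obtain Y where Y: "\<And>n. Y n \<in> W" "\<And>n. X n = T (Y n)" by metis
      have d: "hnorm jp (X n - T w) = hnorm ip (Y n - w)" if w: "w \<in> W" for n w
        using nT[OF Wdiff[OF Y(1) w], of n] unfolding Y(2) TD[OF Y(1) w] .
      have nd: "hnorm jp (T (Y m) - T (Y n)) = hnorm ip (Y m - Y n)" for m n
        using d[OF Y(1), of m n] unfolding Y(2) .
      have "\<forall>e>0. \<exists>N. \<forall>m\<ge>N. \<forall>n\<ge>N. hnorm ip (Y m - Y n) < e"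
        using C unfolding Y(2) nd .
      then obtain l where l: "l \<in> V" "(\<lambda>n. hnorm ip (Y n - l)) \<longlonglongrightarrow> 0"
        using complete_V[of Y] Y WV by blast
      have "ip l v = 0" if v: "v \<in> P" for v
      proof -
        have "cmod (ip l v) \<le> hnorm ip (Y n - l) * hnorm ip v" for n
        proof -
          have "ip (Y n - l) v = - ip l v"
            using ip_diff_left[OF WV[OF Y(1)] l(1) PV[OF v], of n] W0[OF Y(1) v, of n] by simp
          then show ?thesis
            using Cauchy_Schwarz[OF V_diff[OF WV[OF Y(1)] l(1)] PV[OF v], of n] by simp
        qed
        moreover have "(\<lambda>n. hnorm ip (Y n - l) * hnorm ip v) \<longlonglongrightarrow> 0"
          using tendsto_mult_left_zero[OF l(2)] by simp
        ultimately have "cmod (ip l v) \<le> 0"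
          by (intro LIMSEQ_le_const) auto
        then show ?thesis by simp
      qed
      then have "l \<in> W" using l by (simp add: W_def)
      then show ?thesis using l(2) d by (intro bexI[of _ "T l"]) simp_all
    qed
  qed
  have "star_representation (T ` W) jp \<rho>"
  proof (intro star_representation.intro hil star_representation_axioms.intro)
    show "bounded_operator (T ` W) jp (\<rho> a)" for a
    proof -
      obtain B where B: "\<forall>x\<in>V. hnorm ip (\<pi> a x) \<le> B * hnorm ip x"
        using pi_bounded[of a] by (auto simp: bounded_operator_def)
      have "clinear_on (T ` W) (\<rho> a)"
        using pil[of a] by (auto simp: clinear_on_def TA TS tr)
      moreover have "\<forall>x\<in>T ` W. hnorm jp (\<rho> a x) \<le> B * hnorm jp x"
        using B by (auto simp: tr)
      ultimately show ?thesis by (auto simp: bounded_operator_def tr)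
    qed
    show "\<rho> (a + b) x = \<rho> a x + \<rho> b x" if "x \<in> T ` W" for a b x
      using that by (auto simp: tr TA pi_add)
    show "\<rho> (c *\<^sub>C a) x = c *\<^sub>C \<rho> a x" if "x \<in> T ` W" for a c x
      using that by (auto simp: tr TS pi_scaleC)
    show "\<rho> (a * b) x = \<rho> a (\<rho> b x)" if "x \<in> T ` W" for a b x
      using that by (auto simp: tr pi_mult)
    show "adjoint_of (T ` W) jp (\<rho> a) (\<rho> (star a))" for a
      by (auto simp: adjoint_of_def tr adj)
  qed
  then have "represents (T ` W) jp \<rho> (T \<xi>) f"
    using \<xi>W by (auto simp: represents_def f tr)
  then show ?thesis using lin by (auto simp: representable_def)
qed

end

theory Submission
  imports Defs
begin

text \<open>
  The form \<open>(a | b) = f(b\<^sup>* a)\<close> turns \<open>I\<close> into a semi-inner-product space. Instead of completing a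
  quotient of \<open>I\<close>, take for \<open>H\<close> the space of bounded antilinear functionals on \<open>I\<close>, into which
  \<open>I\<close> maps by \<open>a \<mapsto> (a | \<cdot>)\<close>; the image is dense by a Riesz type minimisation, and this determines
  the inner product of \<open>H\<close>. The algebra acts by \<open>(\<pi>(x) u)(b) = u(x\<^sup>* b)\<close>, boundedly since \<open>f\<close> is
  admissible, and \<open>\<xi>(b) = cnj (f b)\<close> is a vector of \<open>H\<close> since \<open>f\<close> is Hilbert bounded. Then
  \<open>f\<^sub>N(x) = (\<pi>(x) \<xi> | \<xi>)\<close> extends \<open>f\<close>. As the norm of \<open>H\<close> is the dual norm, \<open>f\<^sub>N(x\<^sup>* x)\<close> is the
  least \<open>C\<close> with \<open>|f(x\<^sup>* b)|\<^sup>2 \<le> C f(b\<^sup>* b)\<close> for all \<open>b \<in> I\<close>, and by the Cauchy-Schwarz inequality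
  \<open>g(x\<^sup>* x)\<close> is such a \<open>C\<close> for every representable extension \<open>g\<close>.
\<close>

section \<open>The dual of a semi-inner-product space\<close>

text \<open>A discriminant argument, with \<open>Z\<close> standing for a squared modulus
  \<open>|z|^2\<close>: for a displacement \<open>t = r z\<close> up to sign, \<open>|t|^2\<close>
  is \<open>r^2 Z\<close> and the cross term is a multiple of \<open>r Z\<close>. It serves both the
  Cauchy-Schwarz inequality and \<open>dual_approx\<close>.\<close>

lemma quadratic_nonneg_imp_le:
  fixes Z N E :: real
  assumes "0 \<le> Z" "0 \<le> N" "0 \<le> E" and le: "\<And>r. 0 \<le> r \<Longrightarrow> 2 * r * Z \<le> r\<^sup>2 * Z * N + E"
  shows "Z \<le> E * N"
proof (cases "N = 0")
  case True
  show ?thesis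
  proof (cases "Z = 0")
    case False
    then have "Z > 0" using assms by simp
    \<comment> \<open>With \<open>N = 0\<close> the quadratic term is gone, so a large
      \<open>r\<close> contradicts the bound; this one turns the left side into
      \<open>2 * (E + 1)\<close>.\<close>
    then have "2 * (E + 1) \<le> E" using le[of "(E + 1) / Z"] True assms(3) by simp
    then show ?thesis using assms(3) by simp
  qed (use True in simp)
next
  case False
  then have "N > 0" using assms by simp
  \<comment> \<open>The value \<open>r = 1 / N\<close> is the vertex of the parabola.\<close>
  then have "2 * (Z / N) \<le> Z / N + E"
    using le[of "1 / N"] by (simp add: power2_eq_square)
  then show ?thesis using \<open>N > 0\<close> by (simp add: field_simps)
qed

text \<open>Only semi-definite, because \<open>f (star a * a)\<close> may vanish for nonzero
  \<open>a\<close>; the Cauchy-Schwarz inequality of \<open>complex_hilbert_space\<close> is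
  therefore proved again in this setting.\<close>

locale semi_inner_product =
  fixes S :: "'a::complex_vector set" and s :: "'a \<Rightarrow> 'a \<Rightarrow> complex"
  assumes subspace_S: "csubspace S"
    and s_linear: "y \<in> S \<Longrightarrow> clinear_on S (\<lambda>x. s x y)"
    and s_cnj: "x \<in> S \<Longrightarrow> y \<in> S \<Longrightarrow> s y x = cnj (s x y)"
    and s_nonneg: "x \<in> S \<Longrightarrow> 0 \<le> s x x"
begin

lemma S_0: "0 \<in> S" and S_add: "x \<in> S \<Longrightarrow> y \<in> S \<Longrightarrow> x + y \<in> S"
  and S_scale: "x \<in> S \<Longrightarrow> c *\<^sub>C x \<in> S" and S_diff: "x \<in> S \<Longrightarrow> y \<in> S \<Longrightarrow> x - y \<in> S"
  using subspace_S cvec.subspace_0 cvec.subspace_add cvec.subspace_scale cvec.subspace_diff by blast+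

lemma s_add_left: "x \<in> S \<Longrightarrow> y \<in> S \<Longrightarrow> z \<in> S \<Longrightarrow> s (x + y) z = s x z + s y z"
  and s_scale_left: "x \<in> S \<Longrightarrow> z \<in> S \<Longrightarrow> s (c *\<^sub>C x) z = c * s x z"
  using s_linear[of z] by (auto simp: clinear_on_def scaleC_complex_def)

lemma s_diff_left: "x \<in> S \<Longrightarrow> y \<in> S \<Longrightarrow> z \<in> S \<Longrightarrow> s (x - y) z = s x z - s y z"
  using s_add_left[of "x - y" y z] S_diff by simp

lemma s_add_right: "x \<in> S \<Longrightarrow> y \<in> S \<Longrightarrow> z \<in> S \<Longrightarrow> s z (x + y) = s z x + s z y"
  by (metis S_add complex_cnj_add s_add_left s_cnj)

lemma s_scale_right: "x \<in> S \<Longrightarrow> z \<in> S \<Longrightarrow> s z (c *\<^sub>C x) = cnj c * s z x"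
  by (metis S_scale complex_cnj_mult s_scale_left s_cnj)

section \<open>The seminorm and the Cauchy-Schwarz inequality\<close>

abbreviation nrm :: "'a \<Rightarrow> real" where "nrm \<equiv> hnorm s"

lemma nrm_nonneg: "x \<in> S \<Longrightarrow> 0 \<le> nrm x"
  using s_nonneg by (auto simp: hnorm_def less_eq_complex_def)

lemma s_self: "x \<in> S \<Longrightarrow> s x x = of_real ((nrm x)\<^sup>2)"
  using s_nonneg[of x] by (auto simp: hnorm_def less_eq_complex_def complex_eq_iff)

text \<open>The expansion behind both quadratic arguments below: Cauchy-Schwarz and the minimisation
  in \<open>dual_approx\<close>.\<close>

lemma s_add_scale:
  assumes "x \<in> S" "y \<in> S"
  shows "(nrm (x + t *\<^sub>C y))\<^sup>2 = (nrm x)\<^sup>2 + 2 * Re (cnj t * s x y) + (cmod t)\<^sup>2 * (nrm y)\<^sup>2"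
proof -
  have "complex_of_real ((nrm (x + t *\<^sub>C y))\<^sup>2) = s (x + t *\<^sub>C y) (x + t *\<^sub>C y)"
    using assms by (simp add: s_self S_add S_scale)
  also have "\<dots> = s x x + (cnj t * s x y + cnj (cnj t * s x y)) + (t * cnj t) * s y y"
    using assms
    by (simp add: s_add_left s_add_right s_scale_left s_scale_right S_add S_scale
        s_cnj[of x y] algebra_simps)
  also have "\<dots> = of_real ((nrm x)\<^sup>2 + 2 * Re (cnj t * s x y) + (cmod t)\<^sup>2 * (nrm y)\<^sup>2)"
    by (simp only: s_self assms complex_norm_square complex_add_cnj of_real_add of_real_mult)
  finally show ?thesis by (simp only: of_real_eq_iff)
qed

lemma s_Cauchy_Schwarz:
  assumes x: "x \<in> S" and y: "y \<in> S"
  shows "cmod (s x y) \<le> nrm x * nrm y"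
proof -
  have "(cmod (s x y))\<^sup>2 \<le> (nrm x)\<^sup>2 * (nrm y)\<^sup>2"
  proof (rule quadratic_nonneg_imp_le)
    fix r :: real
    \<comment> \<open>The phase of \<open>s x y\<close> makes the cross term real, the sign makes it
      negative.\<close>
    let ?t = "- (r *\<^sub>R s x y)"
    have re: "Re (cnj ?t * s x y) = - (r * (cmod (s x y))\<^sup>2)"
      unfolding cmod_power2 by (simp add: algebra_simps power2_eq_square)
    have cm: "(cmod ?t)\<^sup>2 = r\<^sup>2 * (cmod (s x y))\<^sup>2" by (simp add: power_mult_distrib)
    have "0 \<le> (nrm (x + ?t *\<^sub>C y))\<^sup>2" by simp
    then show "2 * r * (cmod (s x y))\<^sup>2 \<le> r\<^sup>2 * (cmod (s x y))\<^sup>2 * (nrm y)\<^sup>2 + (nrm x)\<^sup>2"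
      unfolding s_add_scale[OF x y] re cm by linarith
  qed auto
  then have "(cmod (s x y))\<^sup>2 \<le> (nrm x * nrm y)\<^sup>2" by (simp add: power_mult_distrib)
  then show ?thesis by (rule power2_le_imp_le) (simp add: nrm_nonneg x y)
qed

text \<open>Cancels one factor \<open>nrm x\<close>, as \<open>s x x\<close> is its square. Thus an
  estimate of a functional at the vector \<open>x\<close> itself becomes an estimate of its
  seminorm.\<close>

lemma nrm_le:
  assumes "x \<in> S" "0 \<le> C" "cmod (s x x) \<le> C * nrm x"
  shows "nrm x \<le> C"
proof (cases "nrm x = 0")
  case False
  then have "nrm x > 0" using nrm_nonneg[OF assms(1)] by simp
  moreover have "nrm x * nrm x \<le> C * nrm x"
    using assms(3) by (simp add: s_self[OF assms(1)] norm_power power2_eq_square norm_mult)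
  ultimately show ?thesis by simp
qed (use assms in simp)

text \<open>Functionals vanish off \<open>S\<close>, so that they are determined by their values on \<open>S\<close>.\<close>

definition dual :: "('a \<Rightarrow> complex) set"
  where "dual = {u. (\<forall>x\<in>S. \<forall>y\<in>S. u (x + y) = u x + u y) \<and>
    (\<forall>c. \<forall>x\<in>S. u (c *\<^sub>C x) = cnj c * u x) \<and> (\<forall>x. x \<notin> S \<longrightarrow> u x = 0) \<and>
    (\<exists>C\<ge>0. \<forall>x\<in>S. cmod (u x) \<le> C * nrm x)}"

lemma dual_add: "u \<in> dual \<Longrightarrow> x \<in> S \<Longrightarrow> y \<in> S \<Longrightarrow> u (x + y) = u x + u y"
  and dual_scale: "u \<in> dual \<Longrightarrow> x \<in> S \<Longrightarrow> u (c *\<^sub>C x) = cnj c * u x"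
  and dual_off: "u \<in> dual \<Longrightarrow> x \<notin> S \<Longrightarrow> u x = 0"
  and dual_bounded: "u \<in> dual \<Longrightarrow> \<exists>C\<ge>0. \<forall>x\<in>S. cmod (u x) \<le> C * nrm x"
  by (auto simp: dual_def)

lemma dual_diff: "u \<in> dual \<Longrightarrow> x \<in> S \<Longrightarrow> y \<in> S \<Longrightarrow> u (x - y) = u x - u y"
  using dual_add[of u "x - y" y] S_diff by simp

lemma subspace_dual: "csubspace dual"
proof (rule cvec.subspaceI)
  show "0 \<in> dual" by (auto simp: dual_def intro!: exI[of _ 0])
next
  fix u v assume uv: "u \<in> dual" "v \<in> dual"
  obtain C D where C: "C \<ge> 0" "\<forall>x\<in>S. cmod (u x) \<le> C * nrm x"
    and D: "D \<ge> 0" "\<forall>x\<in>S. cmod (v x) \<le> D * nrm x"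
    using uv dual_bounded by meson
  have "\<forall>x\<in>S. cmod (u x + v x) \<le> (C + D) * nrm x"
    using C(2) D(2) by (auto simp: distrib_right intro!: norm_triangle_le add_mono)
  then have "\<exists>C\<ge>0. \<forall>x\<in>S. cmod (u x + v x) \<le> C * nrm x" using C D by (intro exI[of _ "C + D"]) simp
  then show "u + v \<in> dual"
    using uv by (auto simp: dual_def algebra_simps)
next
  fix c u assume u: "u \<in> dual"
  obtain C where C: "C \<ge> 0" "\<forall>x\<in>S. cmod (u x) \<le> C * nrm x"
    using u dual_bounded by meson
  have "\<forall>x\<in>S. cmod (c * u x) \<le> (cmod c * C) * nrm x"
    using C by (auto simp: norm_mult mult.assoc intro!: mult_left_mono)
  then have "\<exists>C\<ge>0. \<forall>x\<in>S. cmod (c * u x) \<le> C * nrm x" using C by (intro exI[of _ "cmod c * C"]) simp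
  then show "c *\<^sub>C u \<in> dual"
    using u by (auto simp: dual_def algebra_simps scaleC_fun_def scaleC_complex_def)
qed

section \<open>The Riesz map and the density of its image\<close>

definition embed :: "'a \<Rightarrow> 'a \<Rightarrow> complex"
  where "embed a = (\<lambda>b. if b \<in> S then s a b else 0)"

text \<open>Cauchy-Schwarz gives the bound \<open>nrm a\<close>. Fixing the first argument of
  \<open>s\<close> leaves an antilinear functional, and on \<open>S\<close> the map
  \<open>a \<mapsto> embed a\<close> is linear.\<close>

lemma embed_dual:
  assumes "a \<in> S"
  shows "embed a \<in> dual"
proof -
  have "\<exists>C\<ge>0. \<forall>x\<in>S. cmod (embed a x) \<le> C * nrm x"
    using assms s_Cauchy_Schwarz nrm_nonneg by (intro exI[of _ "nrm a"]) (simp add: embed_def)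
  then show ?thesis
    using assms by (auto simp: dual_def embed_def S_add S_scale s_add_right s_scale_right)
qed

text \<open>A near-minimiser of \<open>\<lambda>a. (nrm a)\<^sup>2 - 2 * Re (u a)\<close> represents \<open>u\<close> approximately.\<close>

lemma dual_approx:
  assumes u: "u \<in> dual" and e: "e > 0"
  shows "\<exists>a\<in>S. \<forall>b\<in>S. cmod (u b - s a b) \<le> e * nrm b"
proof -
  obtain C where C: "C \<ge> 0" "\<forall>x\<in>S. cmod (u x) \<le> C * nrm x"
    using u dual_bounded by meson
  define \<phi> where "\<phi> a = (nrm a)\<^sup>2 - 2 * Re (u a)" for a
  \<comment> \<open>Completing the square \<open>(nrm a - C)\<^sup>2\<close>.\<close>
  have low: "- C\<^sup>2 \<le> \<phi> a" if "a \<in> S" for a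
  proof -
    have "Re (u a) \<le> C * nrm a" using C(2) that complex_Re_le_cmod[of "u a"] by fastforce
    moreover have "0 \<le> (nrm a - C)\<^sup>2" by simp
    ultimately show ?thesis by (simp add: \<phi>_def power2_eq_square algebra_simps)
  qed
  define m where "m = Inf (\<phi> ` S)"
  have bdd: "bdd_below (\<phi> ` S)" using low by (intro bdd_belowI2) auto
  have m: "m \<le> \<phi> a" if "a \<in> S" for a
    unfolding m_def using bdd that by (intro cInf_lower) auto
  have "\<exists>y\<in>\<phi> ` S. y < m + e\<^sup>2"
    unfolding m_def using S_0 e by (intro cInf_lessD) auto
  \<comment> \<open>\<open>S\<close> is not assumed complete, so the infimum may fail to be
    attained. The slack is \<open>e\<^sup>2\<close> because it enters the quadratic inequality as
    \<open>E\<close>, which bounds a squared modulus.\<close>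
  then obtain a where a: "a \<in> S" "\<phi> a < m + e\<^sup>2" by auto
  have "cmod (u b - s a b) \<le> e * nrm b" if b: "b \<in> S" for b
  proof -
    let ?z = "u b - s a b"
    have "(cmod ?z)\<^sup>2 \<le> e\<^sup>2 * (nrm b)\<^sup>2"
    proof (rule quadratic_nonneg_imp_le)
      fix r :: real
      \<comment> \<open>Moving from \<open>a\<close> in the direction of the error
        \<open>u b - s a b\<close> lowers \<open>\<phi>\<close> to first order by
        \<open>2 * r * (cmod ?z)\<^sup>2\<close>; near-minimality limits that gain.\<close>
      let ?t = "r *\<^sub>R ?z"
      have cm: "(cmod ?t)\<^sup>2 = r\<^sup>2 * (cmod ?z)\<^sup>2" by (simp add: power_mult_distrib)
      have "Re (cnj ?t * ?z) = r * (cmod ?z)\<^sup>2"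
        unfolding cmod_power2 by (simp add: algebra_simps power2_eq_square)
      moreover have "Re (u (a + ?t *\<^sub>C b)) = Re (u a) + Re (cnj ?t * u b)"
        using u a b by (simp add: dual_add dual_scale S_scale)
      moreover have "Re (cnj ?t * ?z) = Re (cnj ?t * u b) - Re (cnj ?t * s a b)"
        by (simp only: right_diff_distrib minus_complex.simps)
      ultimately have "\<phi> (a + ?t *\<^sub>C b) = \<phi> a - 2 * r * (cmod ?z)\<^sup>2 + r\<^sup>2 * (cmod ?z)\<^sup>2 * (nrm b)\<^sup>2"
        unfolding \<phi>_def s_add_scale[OF a(1) b] cm by linarith
      moreover have "m \<le> \<phi> (a + ?t *\<^sub>C b)" using a b by (intro m S_add S_scale)
      ultimately show "2 * r * (cmod ?z)\<^sup>2 \<le> r\<^sup>2 * (cmod ?z)\<^sup>2 * (nrm b)\<^sup>2 + e\<^sup>2"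
        using a(2) by simp
    qed auto
    then have "(cmod ?z)\<^sup>2 \<le> (e * nrm b)\<^sup>2" by (simp add: power_mult_distrib)
    then show ?thesis by (rule power2_le_imp_le) (simp add: nrm_nonneg b less_imp_le[OF e])
  qed
  then show ?thesis using a(1) by blast
qed

text \<open>Convergence of \<open>embed (c n)\<close> to \<open>u\<close> in the operator norm,
  spelled out as estimates with errors \<open>e n\<close>, since the inner product on
  \<open>dual\<close> is itself built from such sequences.\<close>

definition approximates :: "(nat \<Rightarrow> 'a) \<Rightarrow> ('a \<Rightarrow> complex) \<Rightarrow> bool"
  where "approximates c u \<longleftrightarrow> (\<forall>n. c n \<in> S) \<and>
    (\<exists>e. e \<longlonglongrightarrow> 0 \<and> (\<forall>n. 0 \<le> e n) \<and> (\<forall>n. \<forall>b\<in>S. cmod (u b - s (c n) b) \<le> e n * nrm b))"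

lemma approximates_exists:
  assumes "u \<in> dual"
  shows "\<exists>c. approximates c u"
proof -
  have "\<forall>n. \<exists>a\<in>S. \<forall>b\<in>S. cmod (u b - s a b) \<le> 1 / real (Suc n) * nrm b"
    using dual_approx[OF assms] by (metis of_nat_0_less_iff zero_less_Suc zero_less_divide_1_iff)
  then obtain c where "\<forall>n. c n \<in> S \<and> (\<forall>b\<in>S. cmod (u b - s (c n) b) \<le> 1 / real (Suc n) * nrm b)"
    by metis
  moreover have "(\<lambda>n. 1 / real (Suc n)) \<longlonglongrightarrow> 0"
    using LIMSEQ_inverse_real_of_nat by (simp add: inverse_eq_divide)
  ultimately show ?thesis
    unfolding approximates_def by (intro exI[of _ c] conjI exI[of _ "\<lambda>n. 1 / real (Suc n)"]) auto
qed

lemma approximates_embed: "a \<in> S \<Longrightarrow> approximates (\<lambda>n. a) (embed a)"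
  unfolding approximates_def by (auto simp: embed_def intro!: exI[of _ "\<lambda>_. 0"])

text \<open>Both \<open>s (c n)\<close> and \<open>s (d m)\<close> are close to \<open>v\<close>, so
  \<open>c n - d m\<close> has small seminorm, and \<open>u\<close> is bounded. Taking
  \<open>d = c\<close> gives a Cauchy property, different sequences give independence of the
  choice.\<close>

lemma approximates_unique:
  assumes u: "u \<in> dual" and c: "approximates c v" and d: "approximates d v"
  shows "\<exists>p q. p \<longlonglongrightarrow> 0 \<and> q \<longlonglongrightarrow> 0 \<and> (\<forall>n m. cmod (u (c n) - u (d m)) \<le> p n + q m)"
proof -
  obtain e where e: "e \<longlonglongrightarrow> 0" "\<And>n. 0 \<le> e n" "\<And>n. c n \<in> S"
      "\<And>n b. b \<in> S \<Longrightarrow> cmod (v b - s (c n) b) \<le> e n * nrm b"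
    using c by (auto simp: approximates_def)
  obtain k where k: "k \<longlonglongrightarrow> 0" "\<And>n. 0 \<le> k n" "\<And>n. d n \<in> S"
      "\<And>n b. b \<in> S \<Longrightarrow> cmod (v b - s (d n) b) \<le> k n * nrm b"
    using d by (auto simp: approximates_def)
  obtain C where C: "C \<ge> 0" "\<forall>x\<in>S. cmod (u x) \<le> C * nrm x"
    using u dual_bounded by meson
  have "cmod (u (c n) - u (d m)) \<le> C * e n + C * k m" for n m
  proof -
    let ?x = "c n - d m"
    have x: "?x \<in> S" using e k S_diff by blast
    \<comment> \<open>The functional \<open>v\<close> is inserted at the difference vector itself,
      which prepares for \<open>nrm_le\<close>.\<close>
    have "s ?x ?x = (v ?x - s (d m) ?x) - (v ?x - s (c n) ?x)"
      using x e(3) k(3) by (simp add: s_diff_left)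
    then have "cmod (s ?x ?x) \<le> (e n + k m) * nrm ?x"
      using norm_triangle_ineq4[of "v ?x - s (d m) ?x" "v ?x - s (c n) ?x"]
        e(4)[OF x, of n] k(4)[OF x, of m] by (simp add: distrib_right)
    then have "nrm ?x \<le> e n + k m" using x e(2) k(2) by (intro nrm_le) auto
    then have "C * nrm ?x \<le> C * (e n + k m)" using C(1) by (rule mult_left_mono)
    moreover have "cmod (u ?x) \<le> C * nrm ?x" using C x by blast
    ultimately show ?thesis using u e(3) k(3) by (simp add: dual_diff distrib_left)
  qed
  moreover have "(\<lambda>n. C * e n) \<longlonglongrightarrow> 0" "(\<lambda>n. C * k n) \<longlonglongrightarrow> 0"
    using e(1) k(1) by (auto intro: tendsto_mult_right_zero)
  ultimately show ?thesis by blast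
qed

text \<open>Forced by the reproducing property \<open>dual_ip u (embed a) = u a\<close> together
  with continuity in the second argument; by \<open>dual_ip_lim\<close> the chosen sequence does not
  affect the value.\<close>

definition dual_ip :: "('a \<Rightarrow> complex) \<Rightarrow> ('a \<Rightarrow> complex) \<Rightarrow> complex"
  where "dual_ip u v = lim (\<lambda>n. u ((SOME c. approximates c v) n))"

text \<open>\<open>approximates_unique\<close> is used twice: the chosen sequence against itself
  shows that the limit exists, and \<open>c\<close> against the chosen sequence shows that it is the
  same.\<close>

lemma dual_ip_lim:
  assumes u: "u \<in> dual" and c: "approximates c v"
  shows "(\<lambda>n. u (c n)) \<longlonglongrightarrow> dual_ip u v"
proof -
  define d where "d = (SOME c. approximates c v)"
  have d: "approximates d v" unfolding d_def using c by (rule someI[of "\<lambda>c. approximates c v"])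
  obtain p q where pq: "p \<longlonglongrightarrow> 0" "q \<longlonglongrightarrow> 0" "\<And>n m. cmod (u (d n) - u (d m)) \<le> p n + q m"
    using approximates_unique[OF u d d] by blast
  have "Cauchy (\<lambda>n. u (d n))"
  proof (rule CauchyI)
    fix r :: real assume "0 < r"
    then have "eventually (\<lambda>n. p n < r / 2 \<and> q n < r / 2) sequentially"
      using pq(1,2) by (intro eventually_conj order_tendstoD(2)) auto
    then obtain N where N: "\<And>n. n \<ge> N \<Longrightarrow> p n < r / 2 \<and> q n < r / 2"
      by (auto simp: eventually_sequentially)
    have "norm (u (d m) - u (d n)) < r" if "m \<ge> N" "n \<ge> N" for m n
      using pq(3)[of m n] N[OF that(1)] N[OF that(2)] by simp
    then show "\<exists>N. \<forall>m\<ge>N. \<forall>n\<ge>N. norm (u (d m) - u (d n)) < r" by blast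
  qed
  then have lim: "(\<lambda>n. u (d n)) \<longlonglongrightarrow> dual_ip u v"
    by (simp add: dual_ip_def d_def[symmetric] Cauchy_convergent_iff convergent_LIMSEQ_iff)
  obtain p' q' where p': "p' \<longlonglongrightarrow> 0" "q' \<longlonglongrightarrow> 0" "\<And>n m. cmod (u (c n) - u (d m)) \<le> p' n + q' m"
    using approximates_unique[OF u c d] by blast
  have "(\<lambda>n. u (c n) - u (d n)) \<longlonglongrightarrow> 0"
  proof (rule tendsto_norm_zero_cancel, rule tendsto_sandwich[OF _ _ tendsto_const])
    show "(\<lambda>n. p' n + q' n) \<longlonglongrightarrow> 0" using tendsto_add[OF p'(1,2)] by simp
  qed (use p'(3) in auto)
  from tendsto_add[OF this lim] show ?thesis by simp
qed

text \<open>The reproducing property: a constant sequence approximates \<open>embed a\<close> with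
  error zero.\<close>

lemma dual_ip_embed: "u \<in> dual \<Longrightarrow> a \<in> S \<Longrightarrow> dual_ip u (embed a) = u a"
  using dual_ip_lim[OF _ approximates_embed, of u a] LIMSEQ_unique[OF tendsto_const] by metis

text \<open>A description symmetric in \<open>u\<close> and \<open>v\<close>, through which
  conjugate symmetry and positivity pass from \<open>s\<close> to the limit. Replacing
  \<open>u (d n)\<close> by \<open>s (c n) (d n)\<close> costs at most
  \<open>e n * nrm (d n)\<close>.\<close>

lemma dual_ip_lim2:
  assumes u: "u \<in> dual" and v: "v \<in> dual" and c: "approximates c u" and d: "approximates d v"
  shows "(\<lambda>n. s (c n) (d n)) \<longlonglongrightarrow> dual_ip u v"
proof -
  obtain e where e: "e \<longlonglongrightarrow> 0" "\<And>n. 0 \<le> e n" "\<And>n. c n \<in> S"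
      "\<And>n b. b \<in> S \<Longrightarrow> cmod (u b - s (c n) b) \<le> e n * nrm b"
    using c by (auto simp: approximates_def)
  obtain k where k: "k \<longlonglongrightarrow> 0" "\<And>n. 0 \<le> k n" "\<And>n. d n \<in> S"
      "\<And>n b. b \<in> S \<Longrightarrow> cmod (v b - s (d n) b) \<le> k n * nrm b"
    using d by (auto simp: approximates_def)
  obtain C where C: "C \<ge> 0" "\<forall>x\<in>S. cmod (v x) \<le> C * nrm x"
    using v dual_bounded by meson
  \<comment> \<open>The seminorms of an approximating sequence stay bounded: test the estimate for
    \<open>v\<close> at \<open>d n\<close> itself.\<close>
  have bd: "nrm (d n) \<le> C + k n" for n
  proof (rule nrm_le)
    have "cmod (s (d n) (d n)) \<le> cmod (v (d n)) + cmod (v (d n) - s (d n) (d n))"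
      using norm_triangle_ineq4[of "v (d n)" "v (d n) - s (d n) (d n)"] by simp
    also have "\<dots> \<le> C * nrm (d n) + k n * nrm (d n)" using C k by (intro add_mono) auto
    finally show "cmod (s (d n) (d n)) \<le> (C + k n) * nrm (d n)" by (simp add: distrib_right)
  qed (use C k in auto)
  have "(\<lambda>n. u (d n) - s (c n) (d n)) \<longlonglongrightarrow> 0"
  proof (rule tendsto_norm_zero_cancel, rule tendsto_sandwich[OF _ _ tendsto_const])
    show "(\<lambda>n. e n * (C + k n)) \<longlonglongrightarrow> 0"
      using tendsto_mult[OF e(1) tendsto_add[OF tendsto_const[of C] k(1)]] by simp
    have "cmod (u (d n) - s (c n) (d n)) \<le> e n * (C + k n)" for n
      using e(4)[OF k(3), of n n] mult_left_mono[OF bd[of n] e(2)[of n]] by linarith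
    then show "\<forall>\<^sub>F n in sequentially. norm (u (d n) - s (c n) (d n)) \<le> e n * (C + k n)" by simp
  qed simp
  from tendsto_diff[OF dual_ip_lim[OF u d] this] show ?thesis by simp
qed

section \<open>Inner product axioms and the operator norm on the dual\<close>

lemma dual_nrm_lim:
  assumes "u \<in> dual" "approximates c u"
  shows "(\<lambda>n. nrm (c n)) \<longlonglongrightarrow> hnorm dual_ip u"
  using dual_ip_lim2[OF assms(1) assms(1) assms(2) assms(2)]
  unfolding hnorm_def by (intro tendsto_real_sqrt tendsto_Re)

lemma dual_ip_cnj:
  assumes "u \<in> dual" "v \<in> dual"
  shows "dual_ip v u = cnj (dual_ip u v)"
proof -
  obtain c d where c: "approximates c u" and d: "approximates d v"
    using assms approximates_exists by meson
  have "s (d n) (c n) = cnj (s (c n) (d n))" for n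
    using c d by (intro s_cnj) (auto simp: approximates_def)
  then show ?thesis
    using dual_ip_lim2[OF assms(2,1) d c] tendsto_cnj[OF dual_ip_lim2[OF assms c d]]
      LIMSEQ_unique by simp
qed

lemma dual_ip_nonneg:
  assumes "u \<in> dual"
  shows "0 \<le> dual_ip u u"
proof -
  obtain c where c: "approximates c u" using assms approximates_exists by meson
  have lim: "(\<lambda>n. s (c n) (c n)) \<longlonglongrightarrow> dual_ip u u" using dual_ip_lim2 assms c by blast
  have nn: "0 \<le> s (c n) (c n)" for n using c by (intro s_nonneg) (auto simp: approximates_def)
  have "0 \<le> Re (dual_ip u u)"
    using nn by (intro LIMSEQ_le_const[OF tendsto_Re[OF lim]]) (auto simp: less_eq_complex_def)
  moreover have "(\<lambda>n. Im (s (c n) (c n))) = (\<lambda>n. 0)"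
    using nn by (auto simp: less_eq_complex_def)
  then have "Im (dual_ip u u) = 0"
    using tendsto_Im[OF lim] by (simp add: LIMSEQ_const_iff)
  ultimately show ?thesis by (simp add: less_eq_complex_def)
qed

text \<open>Cauchy-Schwarz for \<open>c n\<close>, with error \<open>e n\<close>, in the limit.
  Together with \<open>dual_nrm_le\<close> it identifies \<open>hnorm dual_ip\<close> with the
  operator norm.\<close>

lemma dual_bound:
  assumes u: "u \<in> dual" and b: "b \<in> S"
  shows "cmod (u b) \<le> hnorm dual_ip u * nrm b"
proof -
  obtain c where c: "approximates c u" using assms approximates_exists by meson
  obtain e where e: "e \<longlonglongrightarrow> 0" "\<And>n. 0 \<le> e n" "\<And>n. c n \<in> S"
      "\<And>n b. b \<in> S \<Longrightarrow> cmod (u b - s (c n) b) \<le> e n * nrm b"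
    using c by (auto simp: approximates_def)
  have "cmod (u b) \<le> (nrm (c n) + e n) * nrm b" for n
    using norm_triangle_ineq[of "s (c n) b" "u b - s (c n) b"] e(4)[OF b, of n]
      s_Cauchy_Schwarz[OF e(3) b, of n] by (simp add: distrib_right)
  moreover have "(\<lambda>n. (nrm (c n) + e n) * nrm b) \<longlonglongrightarrow> (hnorm dual_ip u + 0) * nrm b"
    by (intro tendsto_intros dual_nrm_lim u c e(1))
  ultimately show ?thesis by (intro LIMSEQ_le_const) auto
qed

text \<open>The squared norm of \<open>u\<close> is the limit of \<open>u (c n)\<close>, hence at
  most the limit of \<open>C * nrm (c n)\<close>, which is \<open>C\<close> times the norm; one
  factor cancels.\<close>

lemma dual_nrm_le:
  assumes u: "u \<in> dual" and C: "0 \<le> C" "\<And>b. b \<in> S \<Longrightarrow> cmod (u b) \<le> C * nrm b"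
  shows "hnorm dual_ip u \<le> C"
proof -
  obtain c where c: "approximates c u" using assms approximates_exists by meson
  have cS: "c n \<in> S" for n using c by (auto simp: approximates_def)
  have 0: "0 \<le> hnorm dual_ip u"
    using dual_ip_nonneg[OF u] by (simp add: hnorm_def less_eq_complex_def)
  have "(hnorm dual_ip u)\<^sup>2 = Re (dual_ip u u)"
    using dual_ip_nonneg[OF u] by (simp add: hnorm_def less_eq_complex_def)
  also have "\<dots> \<le> C * hnorm dual_ip u"
  proof (rule LIMSEQ_le)
    show "(\<lambda>n. Re (u (c n))) \<longlonglongrightarrow> Re (dual_ip u u)" by (intro tendsto_Re dual_ip_lim u c)
    show "(\<lambda>n. C * nrm (c n)) \<longlonglongrightarrow> C * hnorm dual_ip u"
      by (intro tendsto_intros dual_nrm_lim u c)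
    show "\<exists>N. \<forall>n\<ge>N. Re (u (c n)) \<le> C * nrm (c n)"
      using C(2)[OF cS] complex_Re_le_cmod order_trans by blast
  qed
  finally have "hnorm dual_ip u * hnorm dual_ip u \<le> C * hnorm dual_ip u"
    by (simp add: power2_eq_square)
  then show ?thesis using 0 C(1) by (cases "hnorm dual_ip u = 0") auto
qed

text \<open>For definiteness, \<open>dual_bound\<close> makes \<open>u\<close> vanish on
  \<open>S\<close>, and off \<open>S\<close> it vanishes by definition. Completeness is the usual
  argument for dual spaces: the pointwise limit is again bounded and is the limit in norm.\<close>

lemma dual_hilbert: "complex_hilbert_space dual dual_ip"
proof
  show "csubspace dual" by (rule subspace_dual)
  show "dual_ip v u = cnj (dual_ip u v)" if "u \<in> dual" "v \<in> dual" for u v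
    using that by (rule dual_ip_cnj)
  show "0 \<le> dual_ip u u" if "u \<in> dual" for u using that by (rule dual_ip_nonneg)
  show "u = 0" if u: "u \<in> dual" "dual_ip u u = 0" for u
  proof
    fix b show "u b = 0 b"
      using dual_bound[OF u(1), of b] dual_off[OF u(1), of b] u(2)
      by (cases "b \<in> S") (auto simp: hnorm_def)
  qed
  show "clinear_on dual (\<lambda>u. dual_ip u v)" if v: "v \<in> dual" for v
  proof -
    obtain c where c: "approximates c v" using v approximates_exists by meson
    have add: "dual_ip (u + w) v = dual_ip u v + dual_ip w v" if "u \<in> dual" "w \<in> dual" for u w
      using dual_ip_lim[OF cvec.subspace_add[OF subspace_dual that] c]
        tendsto_add[OF dual_ip_lim[OF that(1) c] dual_ip_lim[OF that(2) c]] LIMSEQ_unique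
      by auto
    have scl: "dual_ip (r *\<^sub>C u) v = r * dual_ip u v" if "u \<in> dual" for u r
      using dual_ip_lim[OF cvec.subspace_scale[OF subspace_dual that] c, of r]
        tendsto_mult[OF tendsto_const[of r] dual_ip_lim[OF that(1) c]] LIMSEQ_unique
      by (auto simp: scaleC_fun_def scaleC_complex_def)
    show ?thesis using add scl by (auto simp: clinear_on_def scaleC_complex_def)
  qed
  show "\<exists>l\<in>dual. (\<lambda>n. hnorm dual_ip (X n - l)) \<longlonglongrightarrow> 0"
    if X: "\<forall>n. X n \<in> dual"
      and Ca: "\<forall>e>0. \<exists>N. \<forall>m\<ge>N. \<forall>n\<ge>N. hnorm dual_ip (X m - X n) < e" for X
  proof -
    have X': "X n \<in> dual" for n using X by blast
    have D: "X m - X n \<in> dual" for m n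
      using cvec.subspace_diff[OF subspace_dual X' X'] .
    \<comment> \<open>The Cauchy condition in norm, as a pointwise condition that is uniform
      relative to \<open>nrm b\<close>.\<close>
    have un: "\<exists>N. \<forall>m\<ge>N. \<forall>n\<ge>N. \<forall>b\<in>S. cmod (X m b - X n b) \<le> e * nrm b" if e: "e > 0" for e
    proof -
      obtain N where N: "\<forall>m\<ge>N. \<forall>n\<ge>N. hnorm dual_ip (X m - X n) < e" using Ca e by blast
      have "cmod (X m b - X n b) \<le> e * nrm b" if "m \<ge> N" "n \<ge> N" "b \<in> S" for m n b
      proof -
        have "hnorm dual_ip (X m - X n) * nrm b \<le> e * nrm b"
          using N that nrm_nonneg by (intro mult_right_mono) (auto intro: less_imp_le)
        then show ?thesis using dual_bound[OF D that(3), of m n] by simp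
      qed
      then show ?thesis by blast
    qed
    have conv: "convergent (\<lambda>n. X n b)" for b
    proof (cases "b \<in> S")
      case b: True
      have "Cauchy (\<lambda>n. X n b)"
      proof (rule CauchyI)
        fix r :: real assume r: "0 < r"
        \<comment> \<open>Adding 1 keeps the divisor positive where
          \<open>nrm b = 0\<close>.\<close>
        have "nrm b + 1 > 0" using nrm_nonneg[OF b] by simp
        then have "r / (nrm b + 1) > 0" using r by simp
        then obtain N where
          N: "\<forall>m\<ge>N. \<forall>n\<ge>N. \<forall>b'\<in>S. cmod (X m b' - X n b') \<le> r / (nrm b + 1) * nrm b'"
          using un by meson
        have "r / (nrm b + 1) * nrm b < r"
          using r \<open>nrm b + 1 > 0\<close> by (simp add: divide_less_eq)
        then show "\<exists>N. \<forall>m\<ge>N. \<forall>n\<ge>N. norm (X m b - X n b) < r"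
          using N b by (meson order_le_less_trans)
      qed
      then show ?thesis by (simp add: Cauchy_convergent_iff)
    next
      case False
      then show ?thesis using dual_off[OF X'] by (simp add: convergent_const)
    qed
    define l where "l b = lim (\<lambda>n. X n b)" for b
    have lim: "(\<lambda>n. X n b) \<longlonglongrightarrow> l b" for b
      using conv[of b] by (simp add: l_def convergent_LIMSEQ_iff)
    \<comment> \<open>Let \<open>n\<close> tend to infinity in \<open>un\<close>.\<close>
    have ul: "\<exists>N. \<forall>m\<ge>N. \<forall>b\<in>S. cmod (X m b - l b) \<le> e * nrm b" if e: "e > 0" for e
    proof -
      obtain N where N: "\<forall>m\<ge>N. \<forall>n\<ge>N. \<forall>b\<in>S. cmod (X m b - X n b) \<le> e * nrm b"
        using un[OF e] by blast
      have "cmod (X m b - l b) \<le> e * nrm b" if "m \<ge> N" "b \<in> S" for m b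
        using N that
        by (intro LIMSEQ_le_const2[OF tendsto_norm[OF tendsto_diff[OF tendsto_const lim]]]) auto
      then show ?thesis by blast
    qed
    have l: "l \<in> dual"
    proof -
      have "l (x + y) = l x + l y" if "x \<in> S" "y \<in> S" for x y
        using lim[of "x + y"] tendsto_add[OF lim[of x] lim[of y]] LIMSEQ_unique
        by (auto simp: dual_add[OF X' that])
      moreover have "l (r *\<^sub>C x) = cnj r * l x" if "x \<in> S" for r x
        using lim[of "r *\<^sub>C x"] tendsto_mult[OF tendsto_const[of "cnj r"] lim[of x]] LIMSEQ_unique
        by (auto simp: dual_scale[OF X' that])
      moreover have "l x = 0" if "x \<notin> S" for x
        using lim[of x] by (simp add: dual_off[OF X' that] LIMSEQ_const_iff)
      moreover have "\<exists>C\<ge>0. \<forall>x\<in>S. cmod (l x) \<le> C * nrm x"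
      proof -
        obtain N where N: "\<forall>m\<ge>N. \<forall>b\<in>S. cmod (X m b - l b) \<le> 1 * nrm b"
          using ul[of 1] by auto
        obtain C where C: "C \<ge> 0" "\<forall>x\<in>S. cmod (X N x) \<le> C * nrm x"
          using X' dual_bounded by meson
        have "cmod (l x) \<le> (C + 1) * nrm x" if "x \<in> S" for x
        proof -
          have "cmod (l x) \<le> cmod (X N x) + cmod (X N x - l x)"
            using norm_triangle_ineq4[of "X N x" "X N x - l x"] by simp
          also have "\<dots> \<le> C * nrm x + 1 * nrm x" using N C that by (intro add_mono) auto
          finally show ?thesis by (simp add: distrib_right)
        qed
        then show ?thesis using C(1) by (intro exI[of _ "C + 1"]) auto
      qed
      ultimately show ?thesis by (auto simp: dual_def)
    qed
    have dl: "X n - l \<in> dual" for n using cvec.subspace_diff[OF subspace_dual X' l] .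
    have "(\<lambda>n. hnorm dual_ip (X n - l)) \<longlonglongrightarrow> 0"
    proof (rule LIMSEQ_I)
      fix r :: real assume r: "0 < r"
      \<comment> \<open>Half of \<open>r\<close>, since \<open>dual_nrm_le\<close> gives only a weak
        inequality.\<close>
      obtain N where N: "\<forall>m\<ge>N. \<forall>b\<in>S. cmod (X m b - l b) \<le> r / 2 * nrm b"
        using ul[of "r / 2"] r by auto
      have "norm (hnorm dual_ip (X n - l) - 0) < r" if "n \<ge> N" for n
      proof -
        have "hnorm dual_ip (X n - l) \<le> r / 2"
          using N that r by (intro dual_nrm_le[OF dl]) auto
        moreover have "0 \<le> hnorm dual_ip (X n - l)"
          using dual_ip_nonneg[OF dl] by (simp add: hnorm_def less_eq_complex_def)
        ultimately show ?thesis using r by simp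
      qed
      then show "\<exists>N. \<forall>n\<ge>N. norm (hnorm dual_ip (X n - l) - 0) < r" by blast
    qed
    then show ?thesis using l by blast
  qed
qed

end

section \<open>Representable functionals\<close>

text \<open>All four facts come from the identity
  \<open>g (star b * a) = ip (\<pi> a \<xi>) (\<pi> b \<xi>)\<close>. The Hilbert bound has constant
  the squared norm of \<open>\<xi>\<close>, the admissibility bound the square of an operator bound
  of \<open>\<pi> x\<close>.\<close>

lemma
  fixes g :: "'a::complex_star_algebra \<Rightarrow> complex"
  assumes "representable g"
  shows representable_nonneg: "0 \<le> g (star a * a)"
    and representable_Cauchy_Schwarz:
      "cmod (g (star b * a)) \<le> sqrt (Re (g (star a * a))) * sqrt (Re (g (star b * b)))"
    and representable_hilbert_bounded: "hilbert_bounded UNIV g"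
    and representable_admissible: "admissible UNIV g"
proof -
  obtain V :: "('a option \<Rightarrow> complex) set" and ip \<pi> \<xi> where "represents V ip \<pi> \<xi> g"
    using assms unfolding representable_def by blast
  then have "star_representation V ip \<pi>" and \<xi>: "\<xi> \<in> V" and g: "g a = ip (\<pi> a \<xi>) \<xi>" for a
    by (auto simp: represents_def)
  then interpret star_representation V ip \<pi> by simp
  have piV: "\<pi> a v \<in> V" if "v \<in> V" for a v
    using pi_bounded[of a] that by (auto simp: bounded_operator_def)
  have gm: "g (star b * a) = ip (\<pi> a \<xi>) (\<pi> b \<xi>)" for a b
    using pi_star[of "star b"] \<xi> piV[OF \<xi>] by (simp add: g pi_mult adjoint_of_def star_star)
  then have nn: "g (star a * a) = of_real ((hnorm ip (\<pi> a \<xi>))\<^sup>2)" for a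
    using ip_self piV[OF \<xi>] by simp
  have hn: "0 \<le> hnorm ip v" if "v \<in> V" for v
    using ip_nonneg[OF that] by (simp add: hnorm_def less_eq_complex_def)
  show "0 \<le> g (star a * a)" for a by (simp add: nn less_eq_complex_def)
  show "cmod (g (star b * a)) \<le> sqrt (Re (g (star a * a))) * sqrt (Re (g (star b * b)))" for a b
    using Cauchy_Schwarz[OF piV piV, OF \<xi> \<xi>] by (simp add: gm hnorm_def)
  show "hilbert_bounded UNIV g"
  proof -
    have "(cmod (g a))\<^sup>2 \<le> (hnorm ip \<xi>)\<^sup>2 * (hnorm ip (\<pi> a \<xi>))\<^sup>2" for a
      using power_mono[OF Cauchy_Schwarz[OF piV[OF \<xi>] \<xi>], of a 2]
      by (simp add: g power_mult_distrib mult.commute)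
    then show ?thesis
      unfolding hilbert_bounded_def nn
      by (intro exI[of _ "(hnorm ip \<xi>)\<^sup>2"]) (simp add: less_eq_complex_def flip: of_real_power of_real_mult)
  qed
  show "admissible UNIV g"
    unfolding admissible_def
  proof
    fix x
    obtain B where B: "\<forall>v\<in>V. hnorm ip (\<pi> x v) \<le> B * hnorm ip v"
      using pi_bounded[of x] by (auto simp: bounded_operator_def)
    have "g (star a * star x * x * a) \<le> of_real (B\<^sup>2) * g (star a * a)" for a
    proof -
      have "(hnorm ip (\<pi> x (\<pi> a \<xi>)))\<^sup>2 \<le> (B * hnorm ip (\<pi> a \<xi>))\<^sup>2"
        using B piV \<xi> hn by (intro power_mono) auto
      moreover have "star a * star x * x * a = star (x * a) * (x * a)"
        by (simp add: star_mult mult.assoc)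
      ultimately show ?thesis
        by (simp add: nn pi_mult \<xi> power_mult_distrib less_eq_complex_def
            flip: of_real_power of_real_mult)
    qed
    then show "\<exists>L\<ge>0. \<forall>a\<in>UNIV. g (star a * star x * x * a) \<le> complex_of_real L * g (star a * a)"
      by (intro exI[of _ "B\<^sup>2"]) simp
  qed
qed

text \<open>A left ideal contains \<open>star a * a\<close> along with \<open>a\<close>, so the
  bound for \<open>g\<close> on the whole algebra restricts to \<open>f\<close>.\<close>

lemma representable_extension_hilbert_bounded:
  assumes "left_ideal I" "representable_extension I f g"
  shows "hilbert_bounded I f"
proof -
  have "f a = g a" "f (star a * a) = g (star a * a)" if "a \<in> I" for a
    using assms that by (auto simp: left_ideal_def representable_extension_def)
  then show ?thesis
    using representable_hilbert_bounded[of g] assms(2)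
    by (auto simp: hilbert_bounded_def representable_extension_def)
qed

lemma representable_extension_admissible:
  assumes "left_ideal I" "representable_extension I f g"
  shows "admissible I f"
proof -
  have "f (star a * a) = g (star a * a)" "f (star a * star x * x * a) = g (star a * star x * x * a)"
    if "a \<in> I" for a x
    using assms that by (auto simp: left_ideal_def representable_extension_def)
  then show ?thesis
    using representable_admissible[of g] assms(2)
    by (fastforce simp: admissible_def representable_extension_def)
qed


section \<open>The minimal representable extension\<close>

locale admissible_functional =
  fixes I :: "'a::complex_star_algebra set" and f :: "'a \<Rightarrow> complex"
  assumes left_ideal_I: "left_ideal I" and linear_f: "clinear_on I f"
    and admissible_f: "admissible I f" and hilbert_bounded_f: "hilbert_bounded I f"
begin

section \<open>The semi-inner product defined by the functional\<close>

lemma I_subspace: "csubspace I" and I_mult: "a \<in> I \<Longrightarrow> x * a \<in> I"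
  using left_ideal_I by (auto simp: left_ideal_def)

lemma f_add: "a \<in> I \<Longrightarrow> b \<in> I \<Longrightarrow> f (a + b) = f a + f b"
  and f_scale: "a \<in> I \<Longrightarrow> f (c *\<^sub>C a) = c * f a"
  using linear_f by (auto simp: clinear_on_def scaleC_complex_def)

text \<open>Positivity is hidden in the Hilbert bound, whose left side is real and nonnegative:
  divide by \<open>M\<close> if it is positive.\<close>

lemma f_nonneg:
  assumes "a \<in> I"
  shows "0 \<le> f (star a * a)"
proof -
  obtain M where M: "M \<ge> 0" "\<And>a. a \<in> I \<Longrightarrow> of_real ((cmod (f a))\<^sup>2) \<le> of_real M * f (star a * a)"
    using hilbert_bounded_f unfolding hilbert_bounded_def by blast
  show ?thesis
  proof (cases "M = 0")
    \<comment> \<open>Here the bound at \<open>a\<close> says nothing about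
      \<open>f (star a * a)\<close>, but applied to the element \<open>star a * a\<close> of
      \<open>I\<close> it forces \<open>f\<close> to vanish there.\<close>
    case True
    have "star a * a \<in> I" using assms by (rule I_mult)
    then have "(cmod (f (star a * a)))\<^sup>2 \<le> 0"
      using M(2)[of "star a * a"] True by (simp add: less_eq_complex_def)
    then show ?thesis by simp
  next
    case False
    then have "0 < M" using M(1) by simp
    moreover have "(cmod (f a))\<^sup>2 \<le> M * Re (f (star a * a))" "Im (f (star a * a)) = 0"
      using M(2)[OF assms] False by (auto simp: less_eq_complex_def simp flip: of_real_power)
    moreover from this have "0 \<le> M * Re (f (star a * a))"
      using zero_le_power2[of "cmod (f a)"] by linarith
    ultimately show ?thesis by (simp add: less_eq_complex_def zero_le_mult_iff)
  qed
qed

definition form :: "'a \<Rightarrow> 'a \<Rightarrow> complex"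
  where "form a b = f (star b * a)"

lemma form_add_left: "a \<in> I \<Longrightarrow> b \<in> I \<Longrightarrow> form (a + b) c = form a c + form b c"
  and form_add_right: "a \<in> I \<Longrightarrow> form a (b + c) = form a b + form a c"
  and form_scale_left: "a \<in> I \<Longrightarrow> form (r *\<^sub>C a) c = r * form a c"
  and form_scale_right: "a \<in> I \<Longrightarrow> form a (r *\<^sub>C b) = cnj r * form a b"
  by (simp_all add: form_def star_add star_scaleC distrib_left distrib_right scaleC_mult_left
      scaleC_mult_right f_add f_scale I_mult)

text \<open>Polarisation: the diagonal of the form is real. At \<open>a + b\<close> this makes the
  imaginary parts of \<open>form a b\<close> and \<open>form b a\<close> opposite, at
  \<open>a + \<i> *\<^sub>C b\<close> it makes the real parts equal.\<close>

lemma form_cnj: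
  assumes "a \<in> I" "b \<in> I"
  shows "form b a = cnj (form a b)"
proof -
  have [simp]: "c *\<^sub>C x \<in> I" if "x \<in> I" for c x using that I_subspace cvec.subspace_scale by blast
  have [simp]: "x + y \<in> I" if "x \<in> I" "y \<in> I" for x y
    using that I_subspace cvec.subspace_add by blast
  have real: "Im (form c c) = 0" if "c \<in> I" for c
    using f_nonneg[OF that] by (simp add: form_def less_eq_complex_def)
  have "Im (form (a + b) (a + b)) = 0" "Im (form (a + \<i> *\<^sub>C b) (a + \<i> *\<^sub>C b)) = 0"
    using assms by (simp_all add: real)
  then show ?thesis
    using assms real[of a] real[of b]
    by (simp add: form_add_left form_add_right form_scale_left form_scale_right complex_eq_iff)
qed

sublocale semi_inner_product I form
proof
  show "csubspace I" by (rule I_subspace)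
  show "clinear_on I (\<lambda>x. form x y)" for y
    by (auto simp: clinear_on_def form_add_left form_scale_left scaleC_complex_def)
  show "form y x = cnj (form x y)" if "x \<in> I" "y \<in> I" for x y using that by (rule form_cnj)
  show "0 \<le> form x x" if "x \<in> I" for x using f_nonneg[OF that] by (simp add: form_def)
qed

sublocale D: complex_hilbert_space dual dual_ip
  by (rule dual_hilbert)

section \<open>The action of the algebra on the dual\<close>

lemma form_mult: "a \<in> I \<Longrightarrow> form a (x * b) = form (star x * a) b"
  by (simp add: form_def star_mult mult.assoc)

text \<open>Admissibility read in terms of the seminorm, since
  \<open>star a * star x * x * a\<close> is \<open>star (x * a) * (x * a)\<close>.\<close>

lemma nrm_mult_bounded: "\<exists>B\<ge>0. \<forall>a\<in>I. nrm (x * a) \<le> B * nrm a"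
proof -
  obtain L where L: "L \<ge> 0"
      "\<And>a. a \<in> I \<Longrightarrow> f (star a * star x * x * a) \<le> of_real L * f (star a * a)"
    using admissible_f unfolding admissible_def by blast
  have "nrm (x * a) \<le> sqrt L * nrm a" if "a \<in> I" for a
    using L(2)[OF that]
    by (simp add: hnorm_def form_def star_mult mult.assoc less_eq_complex_def flip: real_sqrt_mult)
  then show ?thesis using L(1) by (intro exI[of _ "sqrt L"]) simp
qed

text \<open>Extends left multiplication: by \<open>form_mult\<close>,
  \<open>act x (embed a) = embed (x * a)\<close> for \<open>a\<close> in \<open>I\<close>. The value
  0 off \<open>I\<close> keeps the result in \<open>dual\<close>.\<close>

definition act :: "'a \<Rightarrow> ('a \<Rightarrow> complex) \<Rightarrow> 'a \<Rightarrow> complex"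
  where "act x u = (\<lambda>b. if b \<in> I then u (star x * b) else 0)"

text \<open>A substitute for the embedded unit: with a unit in \<open>I\<close>,
  \<open>form_cnj\<close> would give \<open>embed 1 b = cnj (f b)\<close> on
  \<open>I\<close>.\<close>

definition cyc :: "'a \<Rightarrow> complex"
  where "cyc = (\<lambda>b. if b \<in> I then cnj (f b) else 0)"

lemma act_bounded: "\<exists>B\<ge>0. \<forall>u\<in>dual. \<forall>b\<in>I. cmod (act x u b) \<le> B * hnorm dual_ip u * nrm b"
proof -
  obtain B where B: "B \<ge> 0" "\<And>a. a \<in> I \<Longrightarrow> nrm (star x * a) \<le> B * nrm a"
    using nrm_mult_bounded[of "star x"] by blast
  have "cmod (act x u b) \<le> B * hnorm dual_ip u * nrm b" if u: "u \<in> dual" and b: "b \<in> I" for u b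
  proof -
    have "cmod (act x u b) \<le> hnorm dual_ip u * nrm (star x * b)"
      using dual_bound[OF u I_mult[OF b]] b by (simp add: act_def)
    also have "\<dots> \<le> hnorm dual_ip u * (B * nrm b)"
      using B(2)[OF b] D.ip_nonneg[OF u]
      by (intro mult_left_mono) (simp_all add: hnorm_def less_eq_complex_def)
    finally show ?thesis by (simp add: mult_ac)
  qed
  then show ?thesis using B(1) by blast
qed

lemma act_dual:
  assumes u: "u \<in> dual"
  shows "act x u \<in> dual"
proof -
  obtain B where B: "B \<ge> 0" "\<forall>u\<in>dual. \<forall>b\<in>I. cmod (act x u b) \<le> B * hnorm dual_ip u * nrm b"
    using act_bounded by blast
  have "0 \<le> B * hnorm dual_ip u"
    using B(1) D.ip_nonneg[OF u] by (simp add: hnorm_def less_eq_complex_def)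
  then have "\<exists>C\<ge>0. \<forall>b\<in>I. cmod (act x u b) \<le> C * nrm b" using B(2) u by blast
  then show ?thesis
    using u by (auto simp: dual_def act_def I_mult S_add S_scale distrib_left scaleC_mult_right)
qed

text \<open>Moving \<open>x\<close> across the form multiplies the errors by a bound for left
  multiplication by \<open>star x\<close>. This is the tool for the adjoint relation.\<close>

lemma act_approximates:
  assumes c: "approximates c u"
  shows "approximates (\<lambda>n. x * c n) (act x u)"
proof -
  obtain e where e: "e \<longlonglongrightarrow> 0" "\<And>n. 0 \<le> e n" "\<And>n. c n \<in> I"
      "\<And>n b. b \<in> I \<Longrightarrow> cmod (u b - form (c n) b) \<le> e n * nrm b"
    using c by (auto simp: approximates_def)
  obtain B where B: "B \<ge> 0" "\<And>a. a \<in> I \<Longrightarrow> nrm (star x * a) \<le> B * nrm a"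
    using nrm_mult_bounded[of "star x"] by blast
  have "cmod (act x u b - form (x * c n) b) \<le> e n * B * nrm b" if b: "b \<in> I" for n b
  proof -
    have "cmod (act x u b - form (x * c n) b) \<le> e n * nrm (star x * b)"
      using e(4)[OF I_mult[OF b], of "star x" n] b e(3) by (simp add: act_def form_mult star_star)
    also have "\<dots> \<le> e n * (B * nrm b)" using B(2)[OF b] e(2) by (rule mult_left_mono)
    finally show ?thesis by (simp add: mult.assoc)
  qed
  moreover have "(\<lambda>n. e n * B) \<longlonglongrightarrow> 0" using e(1) by (rule tendsto_mult_left_zero)
  ultimately show ?thesis
    unfolding approximates_def using e(2,3) B(1)
    by (intro conjI exI[of _ "\<lambda>n. e n * B"]) (auto simp: I_mult)
qed

lemma act_representation: "star_representation dual dual_ip act"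
proof
  show "bounded_operator dual dual_ip (act x)" for x
  proof -
    obtain B where B: "B \<ge> 0" "\<forall>u\<in>dual. \<forall>b\<in>I. cmod (act x u b) \<le> B * hnorm dual_ip u * nrm b"
      using act_bounded by blast
    have "hnorm dual_ip (act x u) \<le> B * hnorm dual_ip u" if u: "u \<in> dual" for u
      using B D.ip_nonneg[OF u] u
      by (intro dual_nrm_le act_dual) (auto simp: hnorm_def less_eq_complex_def)
    moreover have "clinear_on dual (act x)"
      by (auto simp: clinear_on_def act_def fun_eq_iff scaleC_fun_def scaleC_complex_def)
    ultimately show ?thesis by (auto simp: bounded_operator_def act_dual)
  qed
  fix u assume u: "u \<in> dual"
  show "act (x + y) u = act x u + act y u" for x y
    using u by (auto simp: act_def fun_eq_iff star_add distrib_right dual_add I_mult)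
  show "act (c *\<^sub>C x) u = c *\<^sub>C act x u" for c x
    using u by (auto simp: act_def fun_eq_iff star_scaleC scaleC_mult_left dual_scale I_mult
        scaleC_fun_def scaleC_complex_def)
  show "act (x * y) u = act x (act y u)" for x y
    by (auto simp: act_def fun_eq_iff star_mult mult.assoc I_mult)
next
  show "adjoint_of dual dual_ip (act x) (act (star x))" for x
    unfolding adjoint_of_def
  proof (intro ballI)
    fix u v assume u: "u \<in> dual" and v: "v \<in> dual"
    obtain c where c: "approximates c v" using v approximates_exists by blast
    then have "(\<lambda>n. act x u (c n)) = (\<lambda>n. u (star x * c n))"
      by (auto simp: approximates_def act_def)
    \<comment> \<open>Both sides are limits of the same sequence \<open>u (star x * c n)\<close>,
      because \<open>star x * c n\<close> approximates \<open>act (star x) v\<close>.\<close>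
    then show "dual_ip (act x u) v = dual_ip u (act (star x) v)"
      using dual_ip_lim[OF act_dual[OF u] c, of x]
        dual_ip_lim[OF u act_approximates[OF c], of "star x"] LIMSEQ_unique by auto
  qed
qed

text \<open>Boundedness of \<open>cyc\<close> is the Hilbert bound after taking square roots, with
  constant \<open>sqrt M\<close>.\<close>

lemma cyc_dual: "cyc \<in> dual"
proof -
  obtain M where M: "M \<ge> 0" "\<And>a. a \<in> I \<Longrightarrow> of_real ((cmod (f a))\<^sup>2) \<le> of_real M * f (star a * a)"
    using hilbert_bounded_f unfolding hilbert_bounded_def by blast
  have "cmod (cyc a) \<le> sqrt M * nrm a" if "a \<in> I" for a
  proof -
    have "(cmod (f a))\<^sup>2 \<le> M * Re (form a a)"
      using M(2)[OF that] by (simp add: form_def less_eq_complex_def flip: of_real_power)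
    then have "cmod (f a) \<le> sqrt (M * Re (form a a))" by (rule real_le_rsqrt)
    then show ?thesis using that by (simp add: cyc_def hnorm_def real_sqrt_mult)
  qed
  then have "\<exists>C\<ge>0. \<forall>a\<in>I. cmod (cyc a) \<le> C * nrm a" using M(1) by (intro exI[of _ "sqrt M"]) simp
  then show ?thesis by (auto simp: dual_def cyc_def f_add f_scale S_add S_scale)
qed

section \<open>The vector functional of \<open>cyc\<close> and its minimality\<close>

definition minimal_extension :: "'a \<Rightarrow> complex"
  where "minimal_extension x = dual_ip (act x cyc) cyc"

text \<open>\<open>dual\<close> consists of functions on \<open>'a\<close> rather than
  \<open>'a option\<close>; \<open>representableI\<close> moves the representation to the prescribed
  ambient space.\<close>

lemma representable_minimal_extension: "representable minimal_extension"
proof (rule representableI)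
  interpret star_representation dual dual_ip act by (rule act_representation)
  show "represents dual dual_ip act cyc minimal_extension"
    by (simp add: represents_def act_representation cyc_dual minimal_extension_def)
  show "clinear_on UNIV minimal_extension"
    by (simp add: clinear_on_def minimal_extension_def pi_add pi_scaleC cyc_dual act_dual
        D.ip_add_left D.ip_scale_left scaleC_complex_def)
qed

text \<open>On \<open>I\<close>, \<open>act a cyc b\<close> is \<open>cnj (form b a)\<close>. This
  brings in the reproducing property, by which the vector functional extends
  \<open>f\<close>.\<close>

lemma act_cyc:
  assumes "a \<in> I"
  shows "act a cyc = embed a"
proof
  fix b show "act a cyc b = embed a b"
    using assms form_cnj[of b a] by (auto simp: act_def cyc_def embed_def I_mult form_def)
qed

lemma minimal_extension_eq:
  assumes "a \<in> I"
  shows "minimal_extension a = f a"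
proof -
  have "minimal_extension a = cnj (dual_ip cyc (embed a))"
    using dual_ip_cnj[OF cyc_dual embed_dual[OF assms]]
    by (simp add: minimal_extension_def act_cyc assms)
  then show ?thesis using assms dual_ip_embed[OF cyc_dual assms] by (simp add: cyc_def)
qed

lemma representable_extension_minimal_extension: "representable_extension I f minimal_extension"
  by (simp add: representable_extension_def representable_minimal_extension minimal_extension_eq)

lemma minimal_extension_le:
  assumes g: "representable_extension I f g"
  shows "minimal_extension \<preceq> g"
  unfolding functional_le_def positive_functional_def
proof
  fix x
  interpret star_representation dual dual_ip act by (rule act_representation)
  have rep: "representable g" and eq: "\<And>a. a \<in> I \<Longrightarrow> g a = f a"
    using g by (auto simp: representable_extension_def)
  have ax: "act x cyc \<in> dual" using cyc_dual by (rule act_dual)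
  have gx: "0 \<le> g (star x * x)" using rep by (rule representable_nonneg)
  have "minimal_extension (star x * x) = dual_ip (act x cyc) (act x cyc)"
    using pi_star[of "star x"] cyc_dual ax
    by (simp add: minimal_extension_def pi_mult adjoint_of_def star_star)
  also have "\<dots> = of_real ((hnorm dual_ip (act x cyc))\<^sup>2)" using ax by (rule D.ip_self)
  finally have fx: "minimal_extension (star x * x) = of_real ((hnorm dual_ip (act x cyc))\<^sup>2)" .
  \<comment> \<open>As the norm is the operator norm, it suffices to bound the values of
    \<open>act x cyc\<close> on \<open>I\<close>.\<close>
  have "hnorm dual_ip (act x cyc) \<le> sqrt (Re (g (star x * x)))"
  proof (rule dual_nrm_le[OF ax])
    show "0 \<le> sqrt (Re (g (star x * x)))" using gx by (simp add: less_eq_complex_def)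
    fix b assume b: "b \<in> I"
    \<comment> \<open>For \<open>b\<close> in \<open>I\<close> also \<open>star x * b\<close> lies
      in \<open>I\<close>, so \<open>f\<close> may be exchanged for \<open>g\<close>, whose
      Cauchy-Schwarz inequality covers an \<open>x\<close> outside \<open>I\<close>.\<close>
    have "cmod (act x cyc b) = cmod (g (star x * b))"
      using b by (simp add: act_def cyc_def I_mult eq)
    also have "\<dots> \<le> sqrt (Re (g (star b * b))) * sqrt (Re (g (star x * x)))"
      using rep by (rule representable_Cauchy_Schwarz)
    also have "\<dots> = sqrt (Re (g (star x * x))) * nrm b"
      using b by (simp add: hnorm_def form_def eq I_mult)
    finally show "cmod (act x cyc b) \<le> sqrt (Re (g (star x * x))) * nrm b" .
  qed
  then have "(hnorm dual_ip (act x cyc))\<^sup>2 \<le> (sqrt (Re (g (star x * x))))\<^sup>2"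
    using D.ip_nonneg[OF ax] by (intro power_mono) (simp_all add: hnorm_def less_eq_complex_def)
  then show "0 \<le> (g - minimal_extension) (star x * x)"
    using gx by (simp add: fx less_eq_complex_def flip: of_real_power)
qed

end

theorem theorem5p1:
  fixes I :: "'a::complex_star_algebra set" and f :: "'a \<Rightarrow> complex"
  assumes "left_ideal I"
    and "clinear_on I f"
  shows "((\<exists>g. representable_extension I f g) \<longleftrightarrow> admissible I f \<and> hilbert_bounded I f) \<and>
    ((\<exists>g. representable_extension I f g) \<longrightarrow>
      (\<exists>f\<^sub>N. representable_extension I f f\<^sub>N \<and>
        (\<forall>g. representable_extension I f g \<longrightarrow> f\<^sub>N \<preceq> g)))"
proof -
  have ext: "admissible I f \<and> hilbert_bounded I f" if "representable_extension I f g" for g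
    using assms(1) that representable_extension_admissible representable_extension_hilbert_bounded
    by blast
  \<comment> \<open>This one construction yields both the converse implication and the minimality
    claim.\<close>
  have min: "\<exists>f\<^sub>N. representable_extension I f f\<^sub>N \<and> (\<forall>g. representable_extension I f g \<longrightarrow> f\<^sub>N \<preceq> g)"
    if "admissible I f \<and> hilbert_bounded I f"
  proof -
    interpret admissible_functional I f using assms that by unfold_locales auto
    show ?thesis using representable_extension_minimal_extension minimal_extension_le by blast
  qed
  show ?thesis using ext min by blast
qed

end
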